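(* Let $n_v\ge 1$, $N\ge 1$, and let $i_l,j_l$ ($l=1,\dots,n_v$) be integers modulo $N$ with $i_1=j_1=0$. Let $$H_3=\begin{bmatrix}1&\cdots&1\\ x^{i_1}&\cdots&x^{i_{n_v}}\\ x^{j_1}&\cdots&x^{j_{n_v}}\end{bmatrix},$$ a $3N\times n_vN$ matrix. Write $[n_v]=\{1,\dots,n_v\}$. Then $\mathrm{girth}(H_3)>8$ if and only if each two of the following three sets of differences $$\{i_u-i_v\mid u\ne v,\ u,v\in[n_v]\},\quad \{j_u-j_v\mid u\ne v,\ u,v\in[n_v]\},\quad \{(i_u-j_u)-(i_v-j_v)\mid u\neq v,\ u,v\in[n_v]\}$$ contain non-equal values (i.e. the sets are pairwise disjoint) and each set is of maximal size. Equivalently, $\mathrm{girth}(H_3)>8$ if and only if each one of the three sets $$\{i_u-i_v,\ j_u-j_v\mid u\ne v\},\quad \{i_u-i_v,\ (i_u-j_u)-(i_v-j_v)\mid u\ne v\},\quad \{j_u-j_v,\ (i_u-j_u)-(i_v-j_v)\mid u\neq v\},$$ with $u,v$ ranging over $[n_v]$, is of maximal size.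
   Context: $x^r$ denotes the $N\times N$ circulant permutation matrix obtained from the identity by cyclically shifting to the left by $r$ positions; exponents are taken modulo $N$, and $1=x^0$ is the $N\times N$ identity. A set given by listed expressions is "of maximal size" if all the listed values (over all expressions and all index choices) are pairwise distinct modulo $N$. Equality and disjointness are understood in $\mathbb Z/N\mathbb Z$. The Tanner graph of a $0/1$ matrix is the bipartite graph with one check node per row, one variable node per column, and an edge for each entry equal to $1$; $\mathrm{girth}(M)$ is the length of a shortest cycle in the Tanner graph of $M$ ($+\infty$ if there is none). *)

theory Defs
  imports
    "HOL-Library.Extended_Nat"
    "HOL-Number_Theory.Cong"
    "Jordan_Normal_Form.Matrix"
    "Graph_Theory.Pair_Digraph"
begin

text \<open>
  The matrix $x^r$: shifting the identity cyclically to the left by \<open>r\<close> positions moves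
  the entry in column \<open>b + r\<close> (modulo \<open>N\<close>) to column \<open>b\<close>.
\<close>

definition circulant_perm :: "nat \<Rightarrow> int \<Rightarrow> nat mat" where
  "circulant_perm N r =
     mat N N (\<lambda>(a, b). 1\<^sub>m N $$ (a, nat ((int b + r) mod int N)))"

definition circulant_lift :: "nat \<Rightarrow> int mat \<Rightarrow> nat mat" where
  "circulant_lift N P =
     mat (dim_row P * N) (dim_col P * N)
       (\<lambda>(r, c). circulant_perm N (P $$ (r div N, c div N)) $$ (r mod N, c mod N))"

text \<open>Matrix indices start at 0, whereas \<open>i\<close> and \<open>j\<close> are indexed by \<open>1, \<dots>, n\<close>.\<close>

definition H3 :: "nat \<Rightarrow> nat \<Rightarrow> (nat \<Rightarrow> int) \<Rightarrow> (nat \<Rightarrow> int) \<Rightarrow> nat mat" where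
  "H3 N n i j = circulant_lift N (mat 3 n (\<lambda>(r, l). [0, i (Suc l), j (Suc l)] ! r))"

text \<open>
  The undirected Tanner graph is encoded as a symmetric digraph, with check nodes \<open>Inl r\<close>
  and variable nodes \<open>Inr c\<close>.
\<close>

definition tanner_graph :: "nat mat \<Rightarrow> (nat + nat) pair_pre_digraph" where
  "tanner_graph M =
     (let E = {(Inl r, Inr c) | r c. r < dim_row M \<and> c < dim_col M \<and> M $$ (r, c) = 1}
      in \<lparr> pverts = Inl ` {..<dim_row M} \<union> Inr ` {..<dim_col M}, parcs = E \<union> E\<inverse> \<rparr>)"

text \<open>
  Traversing an edge back and forth is a directed cycle of length 2 but not a cycle of the
  undirected graph; directed cycles of length at least 3 in a symmetric simple digraph are
  exactly the cycles of the underlying undirected graph. The infimum of the empty set is \<open>\<infinity>\<close>.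
\<close>

definition girth :: "nat mat \<Rightarrow> enat" where
  "girth M = Inf {enat (length p) | p.
     pre_digraph.cycle (with_proj (tanner_graph M)) p \<and> 3 \<le> length p}"

definition distinct_pairs :: "nat \<Rightarrow> (nat \<times> nat) set" where
  "distinct_pairs n = {(u, v). u \<in> {1..n} \<and> v \<in> {1..n} \<and> u \<noteq> v}"

definition diff :: "(nat \<Rightarrow> int) \<Rightarrow> nat \<times> nat \<Rightarrow> int" where
  "diff a = (\<lambda>(u, v). a u - a v)"

text \<open>
  A set given by listed expressions is represented by the indexed family \<open>f\<close> of these
  expressions over \<open>I\<close>, since maximality of its size depends on the listing. Residue
  classes modulo \<open>N\<close> are represented by their canonical representatives.
\<close>

definition residue_set :: "nat \<Rightarrow> 'a set \<Rightarrow> ('a \<Rightarrow> int) \<Rightarrow> int set" where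
  "residue_set N I f = (\<lambda>k. f k mod int N) ` I"

definition maximal_size :: "nat \<Rightarrow> 'a set \<Rightarrow> ('a \<Rightarrow> int) \<Rightarrow> bool" where
  "maximal_size N I f \<longleftrightarrow> inj_on (\<lambda>k. f k mod int N) I"

end

theory Submission
  imports Defs
begin

text \<open>
  Choosing block rows \<open>r, s\<close> and block columns \<open>l, m\<close>, the path that leaves a check node of block
  row \<open>r\<close> through block column \<open>l\<close>, visits block row \<open>s\<close> and returns to block row \<open>r\<close> through
  block column \<open>m\<close> shifts the check node by a difference \<open>D r s (l, m)\<close>, one of the listed
  differences up to sign. As there are only three block rows, two opposite check nodes of an
  8-cycle lie in the same block row, so an 8-cycle consists of two such paths with equal shifts.
  Cycles of length 4 and 6 are degenerate instances of the same closed walk, where the two paths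
  share edges. Conversely, a coincidence of two differences yields a closed walk of length 8,
  which is a cycle or contains one of length 4 or 6.
\<close>

section \<open>Short cycles in Tanner graphs\<close>

definition tanner_adj :: "nat mat \<Rightarrow> nat \<Rightarrow> nat \<Rightarrow> bool" where
  "tanner_adj M c v \<longleftrightarrow> c < dim_row M \<and> v < dim_col M \<and> M $$ (c, v) = 1"

text \<open>Stated for an arbitrary relation, so that one notion serves both the Tanner graph and
  the arithmetic relation \<open>E\<close> below. Nodes are compared only within their own side of
  the bipartition.\<close>

definition four_cycle :: "('c \<Rightarrow> 'v \<Rightarrow> bool) \<Rightarrow> bool" where
  "four_cycle E \<longleftrightarrow> (\<exists>a b x y. distinct [a, b] \<and> distinct [x, y] \<and>
     E a x \<and> E b x \<and> E b y \<and> E a y)"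

definition six_cycle :: "('c \<Rightarrow> 'v \<Rightarrow> bool) \<Rightarrow> bool" where
  "six_cycle E \<longleftrightarrow> (\<exists>a b c x y z. distinct [a, b, c] \<and> distinct [x, y, z] \<and>
     E a x \<and> E b x \<and> E b y \<and> E c y \<and> E c z \<and> E a z)"

definition eight_cycle :: "('c \<Rightarrow> 'v \<Rightarrow> bool) \<Rightarrow> bool" where
  "eight_cycle E \<longleftrightarrow> (\<exists>a b c d x y z w. distinct [a, b, c, d] \<and> distinct [x, y, z, w] \<and>
     E a x \<and> E b x \<and> E b y \<and> E c y \<and> E c z \<and> E d z \<and> E d w \<and> E a w)"

section \<open>Arcs and directed cycles of the Tanner graph\<close>

lemma parcs_tanner_graph [simp]:
  "(Inl c, Inr v) \<in> parcs (tanner_graph M) \<longleftrightarrow> tanner_adj M c v"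
  "(Inr v, Inl c) \<in> parcs (tanner_graph M) \<longleftrightarrow> tanner_adj M c v"
  "(Inl c, Inl c') \<notin> parcs (tanner_graph M)"
  "(Inr v, Inr v') \<notin> parcs (tanner_graph M)"
  by (auto simp: tanner_graph_def tanner_adj_def Let_def)

lemma parcs_tanner_graph_from:
  "(Inl c, y) \<in> parcs (tanner_graph M) \<longleftrightarrow> (\<exists>v. y = Inr v \<and> tanner_adj M c v)"
  "(Inr v, y) \<in> parcs (tanner_graph M) \<longleftrightarrow> (\<exists>c. y = Inl c \<and> tanner_adj M c v)"
  by (cases y; simp)+

lemma parcs_tanner_graph_pverts:
  "(x, y) \<in> parcs (tanner_graph M) \<Longrightarrow> x \<in> pverts (tanner_graph M)"
  by (auto simp: tanner_graph_def Let_def)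

text \<open>The start vertex of a nonempty walk is the tail of its first arc, so the vertex
  condition in \<open>awalk\<close> follows from the condition on arcs.\<close>

lemma cycle_tanner_graph_iff:
  "pre_digraph.cycle (with_proj (tanner_graph M)) p \<longleftrightarrow>
     p \<noteq> [] \<and> set p \<subseteq> parcs (tanner_graph M) \<and>
     (\<exists>u. pcas u p u \<and> distinct (tl (pawalk_verts u p)))"
proof -
  have "u \<in> pverts (tanner_graph M)"
    if "p \<noteq> []" "set p \<subseteq> parcs (tanner_graph M)" "pcas u p u" for u
    using that by (cases p) (auto intro: parcs_tanner_graph_pverts)
  then show ?thesis
    unfolding pre_digraph.cycle_def pre_digraph.awalk_def
    by (auto simp: cas_with_proj_eq awalk_verts_with_proj_eq)
qed

section \<open>From cyclic node patterns to directed cycles\<close>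

lemma four_cycle_girth:
  assumes "four_cycle (tanner_adj M)"
  shows "\<exists>p. pre_digraph.cycle (with_proj (tanner_graph M)) p \<and> length p = 4"
proof -
  obtain a b x y where "distinct [a, b]" "distinct [x, y]"
    "tanner_adj M a x" "tanner_adj M b x" "tanner_adj M b y" "tanner_adj M a y"
    using assms unfolding four_cycle_def by blast
  then show ?thesis
    by (intro exI[of _ "[(Inl a, Inr x), (Inr x, Inl b), (Inl b, Inr y), (Inr y, Inl a)]"])
      (auto simp: cycle_tanner_graph_iff)
qed

lemma six_cycle_girth:
  assumes "six_cycle (tanner_adj M)"
  shows "\<exists>p. pre_digraph.cycle (with_proj (tanner_graph M)) p \<and> length p = 6"
proof -
  obtain a b c x y z where "distinct [a, b, c]" "distinct [x, y, z]"
    "tanner_adj M a x" "tanner_adj M b x" "tanner_adj M b y" "tanner_adj M c y"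
    "tanner_adj M c z" "tanner_adj M a z"
    using assms unfolding six_cycle_def by blast
  then show ?thesis
    by (intro exI[of _ "[(Inl a, Inr x), (Inr x, Inl b), (Inl b, Inr y), (Inr y, Inl c),
          (Inl c, Inr z), (Inr z, Inl a)]"])
      (auto simp: cycle_tanner_graph_iff)
qed

lemma eight_cycle_girth:
  assumes "eight_cycle (tanner_adj M)"
  shows "\<exists>p. pre_digraph.cycle (with_proj (tanner_graph M)) p \<and> length p = 8"
proof -
  obtain a b c d x y z w where "distinct [a, b, c, d]" "distinct [x, y, z, w]"
    "tanner_adj M a x" "tanner_adj M b x" "tanner_adj M b y" "tanner_adj M c y"
    "tanner_adj M c z" "tanner_adj M d z" "tanner_adj M d w" "tanner_adj M a w"
    using assms unfolding eight_cycle_def by blast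
  then show ?thesis
    by (intro exI[of _ "[(Inl a, Inr x), (Inr x, Inl b), (Inl b, Inr y), (Inr y, Inl c),
          (Inl c, Inr z), (Inr z, Inl d), (Inl d, Inr w), (Inr w, Inl a)]"])
      (auto simp: cycle_tanner_graph_iff)
qed

text \<open>Bipartiteness: consecutive arcs of a walk alternate between the two orientations.\<close>

lemma pcas_tanner_graph_even:
  assumes "set p \<subseteq> parcs (tanner_graph M)" "pcas u p w" "isl u = isl w"
  shows "even (length p)"
proof -
  \<comment> \<open>An equivalence is needed for the induction: dropping the first arc moves the
    start to the other side.\<close>
  have "even (length p) \<longleftrightarrow> isl u = isl w"
    using assms(1,2)
  proof (induction p arbitrary: u)
    case (Cons e p)
    then have "isl (fst e) \<noteq> isl (snd e)"
      by (cases e; cases "fst e") (auto simp: parcs_tanner_graph_from)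
    with Cons show ?case by auto
  qed simp
  with assms show ?thesis by simp
qed

section \<open>Directed cycles of length at most 8\<close>

lemma short_cycle_tanner_graph:
  assumes "pre_digraph.cycle (with_proj (tanner_graph M)) p" "3 \<le> length p" "length p \<le> 8"
  shows "four_cycle (tanner_adj M) \<or> six_cycle (tanner_adj M) \<or> eight_cycle (tanner_adj M)"
proof -
  from assms(1) obtain u where p: "set p \<subseteq> parcs (tanner_graph M)" "pcas u p u"
      "distinct (tl (pawalk_verts u p))"
    by (auto simp: cycle_tanner_graph_iff)
  from pcas_tanner_graph_even[OF p(1,2)] have "even (length p)" by simp
  with assms(2,3) have "length p = 4 \<or> length p = 6 \<or> length p = 8" by presburger
  then consider "length p = 4" | "length p = 6" | "length p = 8" by blast
  then show ?thesis
  proof cases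
    case 1
    then obtain e1 e2 e3 e4 where "p = [e1, e2, e3, e4]"
      by (auto simp: length_Suc_conv numeral_eq_Suc)
    with p(2) obtain y1 y2 y3 where
      q: "p = [(u, y1), (y1, y2), (y2, y3), (y3, u)]"
      by (intro that[of "snd e1" "snd e2" "snd e3"]) (auto simp: prod_eq_iff)
    have "four_cycle (tanner_adj M)"
    proof (cases u)
      case (Inl a)
      with p(1) q obtain x b y where
        eqs: "y1 = Inr x" "y2 = Inl b" "y3 = Inr y"
        and adj: "tanner_adj M a x" "tanner_adj M b x" "tanner_adj M b y" "tanner_adj M a y"
        by (auto simp: parcs_tanner_graph_from)
      have "distinct [a, b]" "distinct [x, y]"
        using p(3) Inl unfolding q eqs by auto
      with adj show ?thesis unfolding four_cycle_def by blast
    next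
      \<comment> \<open>A cycle starting at a variable node is read from the next check node on; its
        start becomes the last variable node of the pattern. The longer cycles are treated
        likewise.\<close>
      case (Inr y)
      with p(1) q obtain a x b where
        eqs: "y1 = Inl a" "y2 = Inr x" "y3 = Inl b"
        and adj: "tanner_adj M a x" "tanner_adj M b x" "tanner_adj M b y" "tanner_adj M a y"
        by (auto simp: parcs_tanner_graph_from)
      have "distinct [a, b]" "distinct [x, y]"
        using p(3) Inr unfolding q eqs by auto
      with adj show ?thesis unfolding four_cycle_def by blast
    qed
    then show ?thesis by blast
  next
    case 2
    then obtain e1 e2 e3 e4 e5 e6 where "p = [e1, e2, e3, e4, e5, e6]"
      by (auto simp: length_Suc_conv numeral_eq_Suc)
    with p(2) obtain y1 y2 y3 y4 y5 where
      q: "p = [(u, y1), (y1, y2), (y2, y3), (y3, y4), (y4, y5), (y5, u)]"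
      by (intro that[of "snd e1" "snd e2" "snd e3" "snd e4" "snd e5"]) (auto simp: prod_eq_iff)
    have "six_cycle (tanner_adj M)"
    proof (cases u)
      case (Inl a)
      with p(1) q obtain x b y c z where
        eqs: "y1 = Inr x" "y2 = Inl b" "y3 = Inr y" "y4 = Inl c"
          "y5 = Inr z"
        and adj: "tanner_adj M a x" "tanner_adj M b x" "tanner_adj M b y" "tanner_adj M c y"
          "tanner_adj M c z" "tanner_adj M a z"
        by (auto simp: parcs_tanner_graph_from)
      have "distinct [a, b, c]" "distinct [x, y, z]"
        using p(3) Inl unfolding q eqs by auto
      with adj show ?thesis unfolding six_cycle_def by blast
    next
      case (Inr z)
      with p(1) q obtain a x b y c where
        eqs: "y1 = Inl a" "y2 = Inr x" "y3 = Inl b" "y4 = Inr y"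
          "y5 = Inl c"
        and adj: "tanner_adj M a x" "tanner_adj M b x" "tanner_adj M b y" "tanner_adj M c y"
          "tanner_adj M c z" "tanner_adj M a z"
        by (auto simp: parcs_tanner_graph_from)
      have "distinct [a, b, c]" "distinct [x, y, z]"
        using p(3) Inr unfolding q eqs by auto
      with adj show ?thesis unfolding six_cycle_def by blast
    qed
    then show ?thesis by blast
  next
    case 3
    then obtain e1 e2 e3 e4 e5 e6 e7 e8 where "p = [e1, e2, e3, e4, e5, e6, e7, e8]"
      by (auto simp: length_Suc_conv numeral_eq_Suc)
    with p(2) obtain y1 y2 y3 y4 y5 y6 y7 where
      q: "p = [(u, y1), (y1, y2), (y2, y3), (y3, y4), (y4, y5), (y5, y6), (y6, y7), (y7, u)]"
      by (intro that[of "snd e1" "snd e2" "snd e3" "snd e4" "snd e5" "snd e6" "snd e7"]) (auto simp: prod_eq_iff)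
    have "eight_cycle (tanner_adj M)"
    proof (cases u)
      case (Inl a)
      with p(1) q obtain x b y c z d w where
        eqs: "y1 = Inr x" "y2 = Inl b" "y3 = Inr y" "y4 = Inl c"
          "y5 = Inr z" "y6 = Inl d" "y7 = Inr w"
        and adj: "tanner_adj M a x" "tanner_adj M b x" "tanner_adj M b y" "tanner_adj M c y"
          "tanner_adj M c z" "tanner_adj M d z" "tanner_adj M d w" "tanner_adj M a w"
        by (auto simp: parcs_tanner_graph_from)
      have "distinct [a, b, c, d]" "distinct [x, y, z, w]"
        using p(3) Inl unfolding q eqs by auto
      with adj show ?thesis unfolding eight_cycle_def by blast
    next
      case (Inr w)
      with p(1) q obtain a x b y c z d where
        eqs: "y1 = Inl a" "y2 = Inr x" "y3 = Inl b" "y4 = Inr y"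
          "y5 = Inl c" "y6 = Inr z" "y7 = Inl d"
        and adj: "tanner_adj M a x" "tanner_adj M b x" "tanner_adj M b y" "tanner_adj M c y"
          "tanner_adj M c z" "tanner_adj M d z" "tanner_adj M d w" "tanner_adj M a w"
        by (auto simp: parcs_tanner_graph_from)
      have "distinct [a, b, c, d]" "distinct [x, y, z, w]"
        using p(3) Inr unfolding q eqs by auto
      with adj show ?thesis unfolding eight_cycle_def by blast
    qed
    then show ?thesis by blast
  qed
qed

lemma enat_less_Inf_iff: "enat k < Inf S \<longleftrightarrow> (\<forall>x\<in>S. enat k < x)"
proof (cases "S = {}")
  case True
  then show ?thesis by (simp add: top_enat_def)
next
  case False
  then obtain x where "x \<in> S" by blast
  \<comment> \<open>\<open>enat\<close> is well-ordered, so the infimum of a nonempty set is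
    attained and a strict lower bound stays strict.\<close>
  then have "Inf S \<in> S" by (rule wellorder_InfI)
  then show ?thesis by (metis Inf_lower less_le_trans)
qed

lemma girth_gt_8_iff:
  "girth M > 8 \<longleftrightarrow> \<not> four_cycle (tanner_adj M) \<and> \<not> six_cycle (tanner_adj M) \<and>
     \<not> eight_cycle (tanner_adj M)"
proof -
  let ?S = "{enat (length p) | p. pre_digraph.cycle (with_proj (tanner_graph M)) p \<and> 3 \<le> length p}"
  have "girth M > 8 \<longleftrightarrow> (\<forall>x\<in>?S. enat 8 < x)"
    using enat_less_Inf_iff[of 8 ?S] by (simp add: girth_def numeral_eq_enat)
  also have "\<dots> \<longleftrightarrow> (\<forall>p. pre_digraph.cycle (with_proj (tanner_graph M)) p \<longrightarrow> 3 \<le> length p \<longrightarrow>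
      8 < length p)"
    by auto
  also have "\<dots> \<longleftrightarrow> \<not> four_cycle (tanner_adj M) \<and> \<not> six_cycle (tanner_adj M) \<and>
     \<not> eight_cycle (tanner_adj M)"
  proof
    assume *: "\<forall>p. pre_digraph.cycle (with_proj (tanner_graph M)) p \<longrightarrow> 3 \<le> length p \<longrightarrow> 8 < length p"
    have "length p \<noteq> 4 \<and> length p \<noteq> 6 \<and> length p \<noteq> 8"
      if "pre_digraph.cycle (with_proj (tanner_graph M)) p" for p
      using *[rule_format, OF that] by auto
    then show "\<not> four_cycle (tanner_adj M) \<and> \<not> six_cycle (tanner_adj M) \<and>
        \<not> eight_cycle (tanner_adj M)"
      using four_cycle_girth six_cycle_girth eight_cycle_girth by blast
  next
    assume "\<not> four_cycle (tanner_adj M) \<and> \<not> six_cycle (tanner_adj M) \<and>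
        \<not> eight_cycle (tanner_adj M)"
    then show "\<forall>p. pre_digraph.cycle (with_proj (tanner_graph M)) p \<longrightarrow> 3 \<le> length p \<longrightarrow>
        8 < length p"
      using short_cycle_tanner_graph not_le by blast
  qed
  finally show ?thesis .
qed

section \<open>Cycles in lifts\<close>

text \<open>The exponents of all three block rows are arbitrary, so that the rows play symmetric
  roles.\<close>

locale lift3 =
  fixes N n :: nat and P :: "nat \<Rightarrow> nat \<Rightarrow> int"
  assumes N: "N > 0"
begin

text \<open>The positions of the ones in the lift: \<open>c div N\<close> and \<open>v div N\<close>
  are the block coordinates, and the block \<open>x^r\<close> has its ones where the row is the
  column plus \<open>r\<close> modulo \<open>N\<close>. \<open>Suc\<close> passes from block columns
  counted from 0 to indices counted from 1.\<close>

definition E :: "nat \<Rightarrow> nat \<Rightarrow> bool" where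
  "E c v \<longleftrightarrow> c < 3 * N \<and> v < n * N \<and>
     [int c = int v + P (c div N) (Suc (v div N))] (mod int N)"

definition D :: "nat \<Rightarrow> nat \<Rightarrow> nat \<times> nat \<Rightarrow> int" where
  "D r s = diff (\<lambda>l. P r l - P s l)"

section \<open>Neighbours of a node within a block\<close>

lemma row_lt: "E c v \<Longrightarrow> c div N < 3"
  by (auto simp: E_def less_mult_imp_div_less)

lemma col_in: "E c v \<Longrightarrow> Suc (v div N) \<in> {1..n}"
  using less_mult_imp_div_less by (fastforce simp: E_def)

lemma eq_if_block_cong:
  assumes "a div N = b div N" "[int a = int b] (mod int N)"
  shows "a = b"
  using assms by (metis cong_def cong_int_iff div_mult_mod_eq)

text \<open>Every block is a permutation matrix. This lemma and its counterpart for columns turn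
  distinctness of neighbours into distinctness of their blocks.\<close>

lemma E_row_unique: "E a x \<Longrightarrow> E b x \<Longrightarrow> a div N = b div N \<Longrightarrow> a = b"
  by (rule eq_if_block_cong) (auto simp: E_def intro: cong_trans cong_sym)

lemma E_col_unique:
  assumes "E a x" "E a y" "x div N = y div N"
  shows "x = y"
proof (rule eq_if_block_cong)
  have "[int x + P (a div N) (Suc (x div N)) = int y + P (a div N) (Suc (x div N))] (mod int N)"
    using assms by (auto simp: E_def intro: cong_trans cong_sym)
  then show "[int x = int y] (mod int N)" by (simp add: cong_add_rcancel)
qed (use assms in simp)

text \<open>A block and a residue determine an index. The number \<open>m\<close> of blocks is free
  because the lemma serves rows (\<open>m = 3\<close>) and columns (\<open>m = n\<close>).\<close>

lemma ex_block:
  assumes "r < m"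
  obtains c where "c < m * N" "c div N = r" "[int c = k] (mod int N)"
proof
  define c where "c = r * N + nat (k mod int N)"
  have lt: "nat (k mod int N) < N" using N by (simp add: nat_less_iff)
  then show "c div N = r" by (simp add: c_def)
  have "c < Suc r * N" using lt by (simp add: c_def)
  also have "\<dots> \<le> m * N" using assms by (intro mult_right_mono) auto
  finally show "c < m * N" .
  show "[int c = k] (mod int N)" using N by (simp add: c_def cong_def)
qed

lemma ex_row:
  assumes "v < n * N" "r < 3"
  obtains c where "E c v" "c div N = r"
  using ex_block[OF assms(2), of "int v + P r (Suc (v div N))"] assms
  by (metis E_def)

lemma ex_col:
  assumes "c < 3 * N" "l \<in> {1..n}"
  obtains v where "E c v" "Suc (v div N) = l"
proof -
  have "l - 1 < n" using assms by auto
  from ex_block[OF this, of "int c - P (c div N) l"] obtain v where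
    v: "v < n * N" "v div N = l - 1" "[int v = int c - P (c div N) l] (mod int N)" .
  have "[int v + P (c div N) l = int c] (mod int N)"
    using cong_add[OF v(3) cong_refl[of "P (c div N) l"]] by simp
  with v assms show ?thesis by (intro that[of v]) (auto simp: E_def cong_sym)
qed

lemma E_diff:
  assumes "E a x" "E b x" "a div N = r" "b div N = s" "Suc (x div N) = l"
  shows "[int a - int b = P r l - P s l] (mod int N)"
proof -
  have "[int a - int b = (int x + P r l) - (int x + P s l)] (mod int N)"
    using assms by (intro cong_diff) (auto simp: E_def)
  then show ?thesis by simp
qed

text \<open>On each of the two column visits the column index cancels and leaves a difference of
  exponents; subtracting the two eliminates the middle check node \<open>b\<close>.\<close>

lemma D_path:
  assumes "E a x" "E b x" "E b y" "E c y"
    and "a div N = r" "b div N = s" "c div N = r" "Suc (x div N) = l" "Suc (y div N) = m"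
  shows "[int a - int c = D r s (l, m)] (mod int N)"
proof -
  have "[(int a - int b) - (int c - int b) = (P r l - P s l) - (P r m - P s m)] (mod int N)"
    using assms by (intro cong_diff E_diff) auto
  then show ?thesis by (simp add: D_def diff_def)
qed

text \<open>Exchanging the rows and exchanging the columns both change the sign. This reduces the
  six ordered pairs of rows to three.\<close>

lemma D_swap: "D s r (u, v) = D r s (v, u)"
  by (simp add: D_def diff_def)

text \<open>
  The pair of block rows \<open>r, s\<close> and the pair \<open>r, t\<close> always share a row; with three block rows
  this loses no pair of the three sets of differences.
\<close>

definition no_coincidence :: bool where
  "no_coincidence \<longleftrightarrow> (\<forall>r s t p q. r < 3 \<longrightarrow> s < 3 \<longrightarrow> t < 3 \<longrightarrow> r \<noteq> s \<longrightarrow> r \<noteq> t \<longrightarrow>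
     p \<in> distinct_pairs n \<longrightarrow> q \<in> distinct_pairs n \<longrightarrow> [D r s p = D r t q] (mod int N) \<longrightarrow>
     s = t \<and> p = q)"

lemma no_coincidenceD:
  assumes no_coincidence "r < 3" "s < 3" "t < 3" "r \<noteq> s" "r \<noteq> t"
    "p \<in> distinct_pairs n" "q \<in> distinct_pairs n" "[D r s p = D r t q] (mod int N)"
  shows "s = t \<and> p = q"
  using assms unfolding no_coincidence_def by blast

lemma edge_pair:
  assumes "E a x" "E a y" "x \<noteq> y"
  shows "(Suc (x div N), Suc (y div N)) \<in> distinct_pairs n"
  using assms E_col_unique[of a x y] col_in[of a x] col_in[of a y]
  by (auto simp: distinct_pairs_def)

text \<open>The halves \<open>a x b y c\<close> and \<open>a w d z c\<close> produce the same shift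
  from \<open>a\<close> to \<open>c\<close>, hence two equal differences. Only backtracking at
  \<open>a\<close>-\<open>b\<close>, \<open>a\<close>-\<open>d\<close> and at the middles of the
  halves is excluded, so that walks arising from shorter cycles are covered.\<close>

lemma closed_walk_coincidence:
  assumes nc: no_coincidence
    and E: "E a x" "E b x" "E b y" "E c y" "E c z" "E d z" "E d w" "E a w"
    and ne: "a \<noteq> b" "a \<noteq> d" "x \<noteq> y" "z \<noteq> w" and row: "a div N = c div N"
  shows "b div N = d div N \<and> x div N = w div N \<and> y div N = z div N"
proof -
  let ?r = "a div N" and ?s = "b div N" and ?t = "d div N"
  have "?r \<noteq> ?s" "?r \<noteq> ?t" using E_row_unique E ne by blast+
  moreover have "[D ?r ?s (Suc (x div N), Suc (y div N)) =
      D ?r ?t (Suc (w div N), Suc (z div N))] (mod int N)"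
    using D_path[of a x b y c] D_path[of a w d z c] E row
    by (metis cong_sym cong_trans)
  moreover have "?r < 3" "?s < 3" "?t < 3" using row_lt E by blast+
  moreover have "(Suc (x div N), Suc (y div N)) \<in> distinct_pairs n"
    "(Suc (w div N), Suc (z div N)) \<in> distinct_pairs n"
    using edge_pair E ne by metis+
  ultimately show ?thesis using no_coincidenceD[OF nc] by blast
qed

lemma no_coincidence_imp_no_short_cycle:
  assumes nc: no_coincidence
  shows "\<not> four_cycle E" "\<not> six_cycle E" "\<not> eight_cycle E"
proof -
  show "\<not> four_cycle E"
  proof
    assume "four_cycle E"
    then obtain a b x y where C: "distinct [a, b]" "distinct [x, y]"
      "E a x" "E b x" "E b y" "E a y"
      unfolding four_cycle_def by blast
    then have "a \<noteq> b" "x \<noteq> y" by auto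
    \<comment> \<open>The 4-cycle is traversed twice: the halves use the block columns of
      \<open>x, y\<close> and of \<open>y, x\<close>, and equating them identifies the two.\<close>
    then have "x div N = y div N"
      using closed_walk_coincidence[OF nc C(3-6) C(3-6)] by blast
    then show False using E_col_unique[of a x y] C by simp
  qed
  show "\<not> six_cycle E"
  proof
    assume "six_cycle E"
    then obtain a b c x y z where C: "distinct [a, b, c]" "distinct [x, y, z]"
      "E a x" "E b x" "E b y" "E c y" "E c z" "E a z"
      unfolding six_cycle_def by blast
    \<comment> \<open>Inserting a detour from \<open>y\<close> to block row \<open>a div N\<close> and back turns the 6-cycle into a closed
      walk of length 8.\<close>
    have "y < n * N" "a div N < 3" using C row_lt by (auto simp: E_def)
    then obtain d where d: "E d y" "d div N = a div N" by (rule ex_row)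
    have "b div N = c div N"
      using closed_walk_coincidence[OF nc, of a x b y d y c z] C d by auto
    then show False using E_row_unique[of b y c] C by simp
  qed
  show "\<not> eight_cycle E"
  proof
    assume "eight_cycle E"
    then obtain a b c d x y z w where C: "distinct [a, b, c, d]" "distinct [x, y, z, w]"
      "E a x" "E b x" "E b y" "E c y" "E c z" "E d z" "E d w" "E a w"
      unfolding eight_cycle_def by blast
    have "a div N \<noteq> b div N" "b div N \<noteq> c div N" "c div N \<noteq> d div N" "d div N \<noteq> a div N"
      using C E_row_unique[of a x b] E_row_unique[of b y c] E_row_unique[of c z d]
        E_row_unique[of d w a] by auto
    moreover have "a div N < 3" "b div N < 3" "c div N < 3" "d div N < 3"
      using C row_lt by blast+
    \<comment> \<open>Pigeonhole: cyclically adjacent check nodes lie in different block rows, and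
      there are only three rows.\<close>
    ultimately consider "a div N = c div N" | "b div N = d div N" by linarith
    then show False
    proof cases
      case 1
      then have "y div N = z div N"
        using closed_walk_coincidence[OF nc, of a x b y c z d w] C by auto
      then show False using E_col_unique[of c y z] C by simp
    next
      case 2
      \<comment> \<open>The same walk, started at \<open>b\<close>.\<close>
      then have "z div N = w div N"
        using closed_walk_coincidence[OF nc, of b y c z d w a x] C by auto
      then show False using E_col_unique[of d z w] C by simp
    qed
  qed
qed

section \<open>From coincidences to short cycles\<close>

lemma ex_path:
  assumes "a < 3 * N" "a div N = r" "s < 3" "l \<in> {1..n}" "m \<in> {1..n}"
  obtains x b y c where "E a x" "E b x" "E b y" "E c y"
    "b div N = s" "c div N = r" "Suc (x div N) = l" "Suc (y div N) = m"
    "[int a - int c = D r s (l, m)] (mod int N)"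
proof -
  obtain x where x: "E a x" "Suc (x div N) = l" using ex_col assms(1,4) by blast
  then have "x < n * N" by (simp add: E_def)
  with assms(3) obtain b where b: "E b x" "b div N = s" using ex_row by blast
  then have "b < 3 * N" by (simp add: E_def)
  with assms(5) obtain y where y: "E b y" "Suc (y div N) = m" using ex_col by blast
  then have "y < n * N" by (simp add: E_def)
  moreover have "r < 3" using row_lt[OF x(1)] assms(2) by simp
  ultimately obtain c where c: "E c y" "c div N = r" using ex_row by blast
  show ?thesis
    by (rule that[OF x(1) b(1) y(1) c(1) b(2) c(2) x(2) y(2)], rule D_path) (use assms x b y c in auto)
qed

text \<open>Both paths are lifted from a common check node \<open>a\<close>; equal differences make
  them end in a common check node \<open>c\<close>. Depending on which inner nodes agree, the
  resulting closed walk contains a cycle of length 4, 6 or 8, or the two paths are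
  identical.\<close>

lemma no_short_cycle_imp_no_coincidence:
  assumes no4: "\<not> four_cycle E" and no6: "\<not> six_cycle E" and no8: "\<not> eight_cycle E"
  shows no_coincidence
  unfolding no_coincidence_def
proof (intro allI impI)
  fix r s t p q
  assume r: "r < 3" and s: "s < 3" and t: "t < 3" and rs: "r \<noteq> s" and rt: "r \<noteq> t"
    and p: "p \<in> distinct_pairs n" and q: "q \<in> distinct_pairs n"
    and cong: "[D r s p = D r t q] (mod int N)"
  obtain l m where lm: "p = (l, m)" "l \<in> {1..n}" "m \<in> {1..n}" "l \<noteq> m"
    using p unfolding distinct_pairs_def by blast
  obtain l' m' where lm': "q = (l', m')" "l' \<in> {1..n}" "m' \<in> {1..n}" "l' \<noteq> m'"
    using q unfolding distinct_pairs_def by blast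
  obtain a where a: "a < 3 * N" "a div N = r" using ex_block[OF r, of 0] by blast
  obtain x b y c where C: "E a x" "E b x" "E b y" "E c y"
    "b div N = s" "c div N = r" "Suc (x div N) = l" "Suc (y div N) = m"
    "[int a - int c = D r s (l, m)] (mod int N)"
    using ex_path[OF a s lm(2,3)] by blast
  obtain w d z c' where C': "E a w" "E d w" "E d z" "E c' z"
    "d div N = t" "c' div N = r" "Suc (w div N) = l'" "Suc (z div N) = m'"
    "[int a - int c' = D r t (l', m')] (mod int N)"
    using ex_path[OF a t lm'(2,3)] by blast
  have "[int a - int c = int a - int c'] (mod int N)"
    using C(9) C'(9) cong lm(1) lm'(1) cong_trans cong_sym by blast
  then have "[int c = int c'] (mod int N)"
    by (simp add: cong_iff_dvd_diff dvd_diff_commute)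
  then have "c = c'" by (rule eq_if_block_cong[rotated]) (use C(6) C'(6) in simp)
  with C'(4) have cz: "E c z" by simp
  note adj = C(1-4) C'(1-3) cz
  have ne: "a \<noteq> b" "c \<noteq> b" "a \<noteq> d" "c \<noteq> d" using a(2) C(5,6) C'(5) rs rt by auto
  have xy: "x \<noteq> y" and wz: "w \<noteq> z" using C(7,8) C'(7,8) lm(4) lm'(4) by auto
  note no4' = no4[unfolded four_cycle_def not_ex, rule_format]
    and no6' = no6[unfolded six_cycle_def not_ex, rule_format]
    and no8' = no8[unfolded eight_cycle_def not_ex, rule_format]
  \<comment> \<open>If the first path were closed, it would already be a 4-cycle.\<close>
  have ac: "a \<noteq> c" using no4'[of a b x y] adj ne xy by auto
  have "b = d"
  proof (rule ccontr)
    assume bd: "b \<noteq> d"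
    \<comment> \<open>Otherwise one variable node would be adjacent to both \<open>a\<close> and
      \<open>c\<close>, which are distinct but share a block row.\<close>
    have xz: "x \<noteq> z" "y \<noteq> w"
      using E_row_unique[of a x c] E_row_unique[of a w c] adj a(2) C(6) ac by auto
    show False
    proof (cases "x = w"; cases "y = z")
      assume "x = w" "y = z"
      then show False using no4'[of b d x y] adj bd xy by auto
    next
      assume "x = w" "y \<noteq> z"
      then show False using no6'[of c b d y x z] adj bd xy xz ne by auto
    next
      assume "x \<noteq> w" "y = z"
      then show False using no6'[of a b d x y w] adj bd xy xz ne by auto
    next
      assume "x \<noteq> w" "y \<noteq> z"
      then show False using no8'[of a b c d x y z w] adj bd xy wz xz ne ac by auto
    qed
  qed
  \<comment> \<open>With a common middle node \<open>b\<close>, different columns on either side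
    would close a 4-cycle.\<close>
  moreover have "x = w" using no4'[of a b x w] adj ne \<open>b = d\<close> by auto
  moreover have "y = z" using no4'[of c b y z] adj ne \<open>b = d\<close> by auto
  ultimately show "s = t \<and> p = q" using C(5,7,8) C'(5,7,8) lm(1) lm'(1) by simp
qed

text \<open>By \<open>D_swap\<close> the row pairs reduce to \<open>D 1 0\<close>,
  \<open>D 2 0\<close> and \<open>D 1 2\<close>. Any two of these share exactly one row, which
  serves as \<open>r\<close>: row 0, 1 and 2 for the three disjointness conditions in the order
  listed. Equal row pairs give the injectivity conditions.\<close>

lemma no_coincidence_iff:
  "no_coincidence \<longleftrightarrow> (\<forall>p\<in>distinct_pairs n. \<forall>q\<in>distinct_pairs n.
     \<not> [D 1 0 p = D 2 0 q] (mod int N) \<and> \<not> [D 1 0 p = D 1 2 q] (mod int N) \<and>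
     \<not> [D 2 0 p = D 1 2 q] (mod int N) \<and>
     ([D 1 0 p = D 1 0 q] (mod int N) \<longrightarrow> p = q) \<and> ([D 2 0 p = D 2 0 q] (mod int N) \<longrightarrow> p = q) \<and>
     ([D 1 2 p = D 1 2 q] (mod int N) \<longrightarrow> p = q))"
  (is "_ \<longleftrightarrow> ?R")
proof
  have swap: "prod.swap p \<in> distinct_pairs n" if "p \<in> distinct_pairs n" for p
    using that by (auto simp: distinct_pairs_def)
  have D: "D s r p = D r s (prod.swap p)" for r s p
    by (cases p) (simp add: D_swap)
  {
    assume nc: no_coincidence
    show ?R
    proof (intro ballI)
      fix p q assume pq: "p \<in> distinct_pairs n" "q \<in> distinct_pairs n"
      note nc' = no_coincidenceD[OF nc]
      have "\<not> [D 1 0 p = D 2 0 q] (mod int N)"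
        using nc'[of 0 1 2 "prod.swap p" "prod.swap q"] pq swap by (auto simp: D[of 0 "Suc 0"] D[of 0 2])
      moreover have "\<not> [D 1 0 p = D 1 2 q] (mod int N)"
        using nc'[of 1 0 2 p q] pq by auto
      moreover have "\<not> [D 2 0 p = D 1 2 q] (mod int N)"
        using nc'[of 2 0 1 p "prod.swap q"] pq swap by (auto simp: D[of 2 "Suc 0"])
      ultimately show "\<not> [D 1 0 p = D 2 0 q] (mod int N) \<and> \<not> [D 1 0 p = D 1 2 q] (mod int N) \<and>
        \<not> [D 2 0 p = D 1 2 q] (mod int N) \<and>
        ([D 1 0 p = D 1 0 q] (mod int N) \<longrightarrow> p = q) \<and> ([D 2 0 p = D 2 0 q] (mod int N) \<longrightarrow> p = q) \<and>
        ([D 1 2 p = D 1 2 q] (mod int N) \<longrightarrow> p = q)"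
        using nc'[of 1 0 0 p q, simplified] nc'[of 2 0 0 p q, simplified]
          nc'[of 1 2 2 p q, simplified] pq by simp
    qed
  }
  {
    assume R: ?R
    show no_coincidence
      unfolding no_coincidence_def
    proof (intro allI impI)
      fix r s t p q
      assume lt: "r < 3" "s < 3" "t < 3" and ne: "r \<noteq> s" "r \<noteq> t"
        and pq: "p \<in> distinct_pairs n" "q \<in> distinct_pairs n"
        and cong: "[D r s p = D r t q] (mod int N)"
      have sp: "prod.swap p \<in> distinct_pairs n" "prod.swap q \<in> distinct_pairs n"
        using swap pq by blast+
      note cong' = cong_sym[OF cong]
      note i0 = R[rule_format, THEN conjunct1]
        and i1 = R[rule_format, THEN conjunct2, THEN conjunct1]
        and i2 = R[rule_format, THEN conjunct2, THEN conjunct2, THEN conjunct1]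
        and inj = R[rule_format, THEN conjunct2, THEN conjunct2, THEN conjunct2]
      have inj_swap: "p = q" if "prod.swap p = prod.swap q"
        using that by (cases p; cases q) simp
      have "r = 0 \<or> r = 1 \<or> r = 2" "s = 0 \<or> s = 1 \<or> s = 2" "t = 0 \<or> t = 1 \<or> t = 2"
        using lt by linarith+
      \<comment> \<open>Each of the three values of \<open>r\<close> leaves two choices for
        \<open>s\<close> and two for \<open>t\<close>; swapping brings every case to the chosen
        representatives.\<close>
      with ne consider "r = 0" "s = 1" "t = 1" | "r = 0" "s = 1" "t = 2"
        | "r = 0" "s = 2" "t = 1" | "r = 0" "s = 2" "t = 2"
        | "r = 1" "s = 0" "t = 0" | "r = 1" "s = 0" "t = 2"
        | "r = 1" "s = 2" "t = 0" | "r = 1" "s = 2" "t = 2"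
        | "r = 2" "s = 0" "t = 0" | "r = 2" "s = 0" "t = 1"
        | "r = 2" "s = 1" "t = 0" | "r = 2" "s = 1" "t = 1"
        by (elim disjE) simp_all
      then show "s = t \<and> p = q"
      proof cases
        case 1
        then show ?thesis using inj[OF sp] cong inj_swap by (simp only: D[of 0 1])
      next
        case 2
        then show ?thesis using i0[OF sp] cong by (simp only: D[of 0 1] D[of 0 2])
      next
        case 3
        then show ?thesis using i0[OF sp(2,1)] cong' by (simp only: D[of 0 1] D[of 0 2])
      next
        case 4
        then show ?thesis using inj[OF sp] cong inj_swap by (simp only: D[of 0 2])
      next
        case 5
        then show ?thesis using inj[OF pq] cong by (simp only:)
      next
        case 6
        then show ?thesis using i1[OF pq] cong by (simp only:)
      next
        case 7
        then show ?thesis using i1[OF pq(2,1)] cong' by (simp only:)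
      next
        case 8
        then show ?thesis using inj[OF pq] cong by (simp only:)
      next
        case 9
        then show ?thesis using inj[OF pq] cong by (simp only:)
      next
        case 10
        then show ?thesis using i2[OF pq(1) sp(2)] cong by (simp only: D[of 2 1])
      next
        case 11
        then show ?thesis using i2[OF pq(2) sp(1)] cong' by (simp only: D[of 2 1])
      next
        case 12
        then show ?thesis using inj[OF sp] cong inj_swap by (simp only: D[of 2 1])
      qed
    qed
  }
qed

section \<open>The Tanner graph of the lift\<close>

lemma girth_lift_iff:
  "girth (circulant_lift N (mat 3 n (\<lambda>(r, l). P r (Suc l)))) > 8 \<longleftrightarrow> no_coincidence"
proof -
  have "tanner_adj (circulant_lift N (mat 3 n (\<lambda>(r, l). P r (Suc l)))) c v \<longleftrightarrow> E c v" for c v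
  proof (cases "c < 3 * N \<and> v < n * N")
    case True
    then have "c div N < 3" "v div N < n" by (auto simp: less_mult_imp_div_less)
    moreover define k where "k = P (c div N) (Suc (v div N))"
    moreover have "c mod N < N" "v mod N < N" using N by auto
    moreover have "nat ((int (v mod N) + k) mod int N) < N" using N by (simp add: nat_less_iff)
    \<comment> \<open>The positions inside a block may be replaced by the full indices, which are
      congruent to them modulo \<open>N\<close>.\<close>
    moreover have "c mod N = nat ((int (v mod N) + k) mod int N) \<longleftrightarrow>
        [int c = int v + k] (mod int N)"
    proof -
      have "c mod N = nat ((int (v mod N) + k) mod int N) \<longleftrightarrow>
          int (c mod N) = (int (v mod N) + k) mod int N"
        using N by (auto simp: nat_eq_iff2)
      then show ?thesis by (simp add: cong_def zmod_int mod_add_left_eq)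
    qed
    ultimately show ?thesis using True
      by (simp add: tanner_adj_def E_def circulant_lift_def circulant_perm_def)
  next
    case False
    then show ?thesis by (auto simp: tanner_adj_def E_def circulant_lift_def)
  qed
  then have "tanner_adj (circulant_lift N (mat 3 n (\<lambda>(r, l). P r (Suc l)))) = E" by blast
  then show ?thesis
    using girth_gt_8_iff no_coincidence_imp_no_short_cycle no_short_cycle_imp_no_coincidence
    by metis
qed

end

section \<open>Residue sets\<close>

lemma residue_set_disjoint_iff:
  "residue_set N I f \<inter> residue_set N J g = {} \<longleftrightarrow>
     (\<forall>p\<in>I. \<forall>q\<in>J. \<not> [f p = g q] (mod int N))"
  by (auto simp: residue_set_def cong_def)

lemma maximal_size_iff:
  "maximal_size N I f \<longleftrightarrow> (\<forall>p\<in>I. \<forall>q\<in>I. [f p = f q] (mod int N) \<longrightarrow> p = q)"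
  by (simp add: maximal_size_def inj_on_def cong_def)

text \<open>Injectivity on a disjoint sum splits into injectivity on both summands and disjointness
  of the images. This links the two forms of the criterion.\<close>

lemma maximal_size_Plus_iff:
  "maximal_size N (I <+> J) (case_sum f g) \<longleftrightarrow> maximal_size N I f \<and> maximal_size N J g \<and>
     residue_set N I f \<inter> residue_set N J g = {}"
proof -
  have "Inl ` I - Inr ` J = Inl ` I" "Inr ` J - Inl ` I = Inr ` J" by auto
  then show ?thesis
    by (simp add: maximal_size_def residue_set_def Plus_def inj_on_Un image_image
        comp_inj_on_iff o_def)
qed

theorem theorem37:
  fixes n N :: nat and i j :: "nat \<Rightarrow> int"
  assumes "n \<ge> 1" and "N \<ge> 1"
    and "[i 1 = 0] (mod int N)" and "[j 1 = 0] (mod int N)"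
  defines "I \<equiv> distinct_pairs n"
    and "di \<equiv> diff i"
    and "dj \<equiv> diff j"
    and "dij \<equiv> diff (\<lambda>u. i u - j u)"
  shows "(girth (H3 N n i j) > 8 \<longleftrightarrow>
            residue_set N I di \<inter> residue_set N I dj = {} \<and>
            residue_set N I di \<inter> residue_set N I dij = {} \<and>
            residue_set N I dj \<inter> residue_set N I dij = {} \<and>
            maximal_size N I di \<and> maximal_size N I dj \<and> maximal_size N I dij)
       \<and> (girth (H3 N n i j) > 8 \<longleftrightarrow>
            maximal_size N (I <+> I) (case_sum di dj) \<and>
            maximal_size N (I <+> I) (case_sum di dij) \<and>
            maximal_size N (I <+> I) (case_sum dj dij))"
proof -
  define P where "P = (\<lambda>r l. [0, i l, j l] ! r)"
  interpret lift3 N n P using assms(2) by unfold_locales simp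
  \<comment> \<open>Row 0 carries the exponent 0 of the identity blocks, so comparing with it leaves
    \<open>i\<close> and \<open>j\<close> themselves; rows 1 and 2 give their difference.\<close>
  have D: "D 1 0 = di" "D 2 0 = dj" "D 1 2 = dij"
    unfolding D_def di_def dj_def dij_def by (simp_all add: P_def)
  have "girth (H3 N n i j) > 8 \<longleftrightarrow> no_coincidence"
    using girth_lift_iff by (simp add: H3_def P_def)
  also have "\<dots> \<longleftrightarrow>
      residue_set N I di \<inter> residue_set N I dj = {} \<and>
      residue_set N I di \<inter> residue_set N I dij = {} \<and>
      residue_set N I dj \<inter> residue_set N I dij = {} \<and>
      maximal_size N I di \<and> maximal_size N I dj \<and> maximal_size N I dij"
    unfolding no_coincidence_iff D residue_set_disjoint_iff maximal_size_iff I_def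
    by (simp only: ball_conj_distrib)
  \<comment> \<open>The three sums contribute each disjointness condition once and each maximality
    condition twice.\<close>
  finally show ?thesis unfolding maximal_size_Plus_iff by blast
qed

end
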